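(* Let $n\geq 3$, let $V=\{1,2,\ldots,n\}$ and let $k$ be an integer with $0<k<n-2$. Let $\Phi_{V,k}=\sum_{F}\prod_{e\in E(F)}x_e$, where $F$ runs over all forests with vertex set $V$ having exactly $k$ connected components, in the variables $x_e$, $e\in\binom{V}{2}$. Let $\widetilde H_{\Phi_{V,k}}$ be the Hessian matrix $\left(\frac{\partial^2 \Phi_{V,k}}{\partial x_e\,\partial x_{e'}}\right)_{e,e'\in\binom{V}{2}}$ evaluated at $x_e=1$ for all $e$. Then $\det \widetilde H_{\Phi_{V,k}}\neq 0$, and $\widetilde H_{\Phi_{V,k}}$ has exactly one positive eigenvalue.
   Context: $\binom{V}{2}$ denotes the set of 2-element subsets of $V$, i.e. the edge set of the complete graph $K_V$. A forest is a graph without cycles; a forest "with vertex set $V$" is a spanning subgraph of $K_V$ without cycles. The eigenvalues are those of the real symmetric matrix $\widetilde H_{\Phi_{V,k}}$, counted with multiplicity. *)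

theory Defs
  imports "HOL-Analysis.Derivative" "Jordan_Normal_Form.Char_Poly"
begin

definition all_edges :: "'a set \<Rightarrow> 'a set set" where
  "all_edges V = {e. e \<subseteq> V \<and> card e = 2}"

definition is_cycle :: "'a set set \<Rightarrow> 'a list \<Rightarrow> bool" where
  "is_cycle E p \<longleftrightarrow> length p \<ge> 3 \<and> distinct p \<and>
     (\<forall>i < length p. {p ! i, p ! ((i + 1) mod length p)} \<in> E)"

definition is_forest :: "'a set set \<Rightarrow> bool" where
  "is_forest E \<longleftrightarrow> (\<nexists>p. is_cycle E p)"

definition graph_components :: "'a set \<Rightarrow> 'a set set \<Rightarrow> 'a set set" where
  "graph_components V E = V // {(u, v). u \<in> V \<and> v \<in> V \<and> (u, v) \<in> {(a, b). {a, b} \<in> E}\<^sup>*}"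

text \<open>A spanning subgraph of the complete graph on \<open>V\<close> is given by its edge set.\<close>

definition forests :: "'a set \<Rightarrow> nat \<Rightarrow> 'a set set set" where
  "forests V k = {F. F \<subseteq> all_edges V \<and> is_forest F \<and> card (graph_components V F) = k}"

text \<open>Polynomials in the variables \<open>x\<^sub>e\<close> are represented by the real functions they define on
  assignments \<open>x\<close>; over the reals, formal and analytic partial derivatives agree.\<close>

definition forest_poly :: "'a set \<Rightarrow> nat \<Rightarrow> ('a set \<Rightarrow> real) \<Rightarrow> real" where
  "forest_poly V k x = (\<Sum>F \<in> forests V k. \<Prod>e\<in>F. x e)"

definition partial_deriv :: "'i \<Rightarrow> (('i \<Rightarrow> real) \<Rightarrow> real) \<Rightarrow> ('i \<Rightarrow> real) \<Rightarrow> real" where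
  "partial_deriv i f x = deriv (\<lambda>t. f (x(i := t))) (x i)"

text \<open>The list \<open>vs\<close> enumerates the variables and fixes the order of rows and columns.\<close>

definition hessian_mat :: "'i list \<Rightarrow> (('i \<Rightarrow> real) \<Rightarrow> real) \<Rightarrow> ('i \<Rightarrow> real) \<Rightarrow> real mat" where
  "hessian_mat vs f x = mat (length vs) (length vs)
     (\<lambda>(r, c). partial_deriv (vs ! r) (partial_deriv (vs ! c) f) x)"

text \<open>Eigenvalues are counted with their multiplicity as roots of the characteristic polynomial.\<close>

definition num_pos_eigenvalues :: "real mat \<Rightarrow> nat" where
  "num_pos_eigenvalues A = (\<Sum>a | eigenvalue A a \<and> a > 0. Polynomial.order a (char_poly A))"

end

theory Submission
  imports Defs "HOL-Combinatorics.Permutations"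
begin

text \<open>
  Deleting two edges \<open>e\<close>, \<open>e'\<close> from a forest with \<open>k\<close> components leaves a forest \<open>G\<close> with
  \<open>k + 2\<close> components, and whether both edges can be put back depends only on which of their
  endpoints are connected in \<open>G\<close>. Fix four vertices, let \<open>q\<close> be the number of such \<open>G\<close> in which
  they lie in four different components, and \<open>p\<close> the number of those in which exactly one
  prescribed pair of them is connected. By symmetry the number of forests through two adjacent edges is
  \<open>a = q + 3 p\<close>, and through two disjoint edges it is \<open>b = q + 4 p\<close>, hence \<open>0 < a \<le> b < 2 a\<close>.
  The Hessian entry at \<open>(e, e')\<close> is \<open>b - (2 a - b) [e = e'] - (b - a) |e \<inter> e'|\<close>, and
  \<open>|e \<inter> e'|\<close> is the Gram matrix of the incidence vectors. So the Hessian is \<open>b J\<close>, with \<open>J\<close> the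
  all-ones matrix, minus a positive definite matrix: it is negative definite on the orthogonal
  complement of the all-ones vector, which is itself an eigenvector with positive eigenvalue.
\<close>

subsection \<open>Connectivity and forests\<close>

text \<open>The reachability relation inside \<open>graph_components\<close>, freed from
  \<open>V\<close>, so that connectivity patterns become formulas in one binary predicate.\<close>

definition conn :: "'a set set \<Rightarrow> 'a \<Rightarrow> 'a \<Rightarrow> bool" where
  "conn E x y \<longleftrightarrow> (x, y) \<in> {(a, b). {a, b} \<in> E}\<^sup>*"

lemma conn_refl [simp]: "conn E x x"
  by (simp add: conn_def)

lemma conn_sym: "conn E x y \<Longrightarrow> conn E y x"
proof -
  have "sym {(a, b). {a, b} \<in> E}"
    by (auto simp: sym_def insert_commute)
  then show "conn E x y \<Longrightarrow> conn E y x"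
    unfolding conn_def by (meson sym_rtrancl symD)
qed

lemma conn_trans: "conn E x y \<Longrightarrow> conn E y z \<Longrightarrow> conn E x z"
  by (simp add: conn_def)

lemma conn_edge: "{x, y} \<in> E \<Longrightarrow> conn E x y"
  by (auto simp: conn_def)

text \<open>A walk can be shortened until it crosses the new edge at most once, in one of two
  directions. Connectivity after adding an edge thus becomes a propositional formula in the old
  connectivity.\<close>

lemma conn_insert:
  "conn (insert {u, v} G) x y \<longleftrightarrow>
     conn G x y \<or> conn G x u \<and> conn G v y \<or> conn G x v \<and> conn G u y"
proof -
  have "{(a, b). {a, b} \<in> insert {u, v} G} = insert (u, v) (insert (v, u) {(a, b). {a, b} \<in> G})"
    by (auto simp: doubleton_eq_iff)
  then have "conn (insert {u, v} G) x y \<longleftrightarrow>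
     (x, y) \<in> (insert (u, v) (insert (v, u) {(a, b). {a, b} \<in> G}))\<^sup>*"
    by (simp add: conn_def)
  then show ?thesis
    unfolding rtrancl_insert
    by (auto simp flip: conn_def) (blast intro: conn_trans conn_sym)+
qed

section \<open>Paths and cycles\<close>

text \<open>Follow the walk step by step: if the next vertex is already on the path, cut the path
  there, otherwise append it.\<close>

lemma conn_imp_distinct_path:
  assumes "conn E x y"
  shows "\<exists>p. p \<noteq> [] \<and> hd p = x \<and> last p = y \<and> distinct p \<and>
    (\<forall>i. Suc i < length p \<longrightarrow> {p ! i, p ! Suc i} \<in> E)"
  using assms unfolding conn_def
proof (induction rule: rtrancl_induct)
  case base
  show ?case by (rule exI[of _ "[x]"]) simp
next
  case (step y z)
  then obtain p where p: "p \<noteq> []" "hd p = x" "last p = y" "distinct p"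
    "\<forall>i. Suc i < length p \<longrightarrow> {p ! i, p ! Suc i} \<in> E" by blast
  show ?case
  proof (cases "z \<in> set p")
    case True
    then obtain j where j: "j < length p" "p ! j = z" by (auto simp: in_set_conv_nth)
    let ?q = "take (Suc j) p"
    have "last ?q = z"
      using j by (simp add: take_Suc_conv_app_nth)
    moreover have "hd ?q = x" using p by (cases p) auto
    ultimately show ?thesis
      using p by (intro exI[of _ ?q]) auto
  next
    case False
    have "{(p @ [z]) ! i, (p @ [z]) ! Suc i} \<in> E" if "Suc i < length (p @ [z])" for i
    proof (cases "Suc i = length p")
      case True
      then have "p ! i = y" using p by (metis diff_Suc_1 last_conv_nth)
      then show ?thesis using step True by (simp add: nth_append)
    next
      case False
      then show ?thesis using p that by (auto simp: nth_append)
    qed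
    then show ?thesis
      using p False by (intro exI[of _ "p @ [z]"]) auto
  qed
qed

lemma path_imp_conn:
  assumes "\<forall>i. Suc i < length p \<longrightarrow> {p ! i, p ! Suc i} \<in> E" and "j < length p"
  shows "conn E (p ! 0) (p ! j)"
  using assms(2)
proof (induction j)
  case (Suc j)
  then show ?case using assms(1) conn_edge conn_trans by (metis Suc_lessD)
qed simp

text \<open>Allows any chosen edge of a cycle to be made its closing edge.\<close>

lemma is_cycle_rotate:
  assumes "is_cycle E p"
  shows "is_cycle E (rotate m p)"
proof -
  have l: "length p > 0" using assms by (auto simp: is_cycle_def)
  have "{rotate m p ! i, rotate m p ! ((i + 1) mod length p)} \<in> E" if "i < length p" for i
  proof -
    have "((m + (i + 1) mod length p) mod length p) = ((m + i) mod length p + 1) mod length p"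
      by (metis add.assoc mod_add_left_eq mod_add_right_eq)
    then show ?thesis
      using assms l that by (simp add: is_cycle_def nth_rotate)
  qed
  then show ?thesis using assms by (simp add: is_cycle_def)
qed

lemma is_forest_mono: "is_forest F \<Longrightarrow> G \<subseteq> F \<Longrightarrow> is_forest G"
  unfolding is_forest_def is_cycle_def by blast

text \<open>A repetition-free path from \<open>u\<close> to \<open>v\<close> in \<open>G\<close>
  would be closed to a cycle by the new edge.\<close>

lemma not_conn_if_insert_forest:
  assumes "u \<noteq> v" and new: "{u, v} \<notin> G" and f: "is_forest (insert {u, v} G)"
  shows "\<not> conn G u v"
proof
  assume "conn G u v"
  from conn_imp_distinct_path[OF this] obtain p where p: "p \<noteq> []" "hd p = u" "last p = v" "distinct p"
    "\<forall>i. Suc i < length p \<longrightarrow> {p ! i, p ! Suc i} \<in> G"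
    by (elim exE conjE)
  have ends: "p ! 0 = u" "p ! (length p - 1) = v"
    using p by (auto simp: hd_conv_nth last_conv_nth)
  \<comment> \<open>One vertex would mean \<open>u = v\<close>, and two vertices would put
    \<open>{u, v}\<close> into \<open>G\<close>.\<close>
  have "length p \<noteq> 1" using ends \<open>u \<noteq> v\<close> by auto
  moreover have "length p \<noteq> 2" using ends new p(5)[rule_format, of 0] by (auto simp: numeral_2_eq_2)
  ultimately have len: "length p \<ge> 3" using p(1) by (cases "length p") auto
  have "{p ! i, p ! ((i + 1) mod length p)} \<in> insert {u, v} G" if "i < length p" for i
  proof (cases "Suc i < length p")
    case True
    then show ?thesis using p by simp
  next
    case False
    then have "i = length p - 1" "Suc i = length p" using that by auto
    then show ?thesis using ends by (simp add: insert_commute)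
  qed
  then have "is_cycle (insert {u, v} G) p" using len p by (simp add: is_cycle_def)
  then show False using f by (auto simp: is_forest_def)
qed

text \<open>A cycle in the larger graph must use the new edge; the rest of the cycle is a path in
  \<open>G\<close> joining \<open>u\<close> and \<open>v\<close>.\<close>

lemma is_forest_insert:
  assumes G: "is_forest G" and nc: "\<not> conn G u v"
  shows "is_forest (insert {u, v} G)"
  unfolding is_forest_def
proof
  assume "\<exists>p. is_cycle (insert {u, v} G) p"
  then obtain p where p: "is_cycle (insert {u, v} G) p" by blast
  have "\<not> is_cycle G p" using G by (auto simp: is_forest_def)
  then obtain i where i: "i < length p" "{p ! i, p ! ((i + 1) mod length p)} = {u, v}"
    using p unfolding is_cycle_def by auto
  \<comment> \<open>Rotating by \<open>i + 1\<close> turns the edge at position \<open>i\<close>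
    into the one from the last vertex back to the first.\<close>
  define q where "q = rotate (i + 1) p"
  define l where "l = length q"
  have q: "is_cycle (insert {u, v} G) q" using p is_cycle_rotate q_def by blast
  then have len: "l \<ge> 3" and d: "distinct q"
    and e: "\<And>j. j < l \<Longrightarrow> {q ! j, q ! ((j + 1) mod l)} \<in> insert {u, v} G"
    by (auto simp: is_cycle_def l_def)
  have lp: "length p = l" by (simp add: l_def q_def)
  have rot: "q ! j = p ! ((i + 1 + j) mod l)" if "j < l" for j
    unfolding q_def using nth_rotate that lp by metis
  have "q ! 0 = p ! ((i + 1) mod l)" using rot[of 0] len by simp
  moreover have "(i + 1 + (l - 1)) mod l = i" using i lp len by simp
  then have "q ! (l - 1) = p ! i"
    using rot[of "l - 1"] len by simp
  ultimately have uv: "{q ! (l - 1), q ! 0} = {u, v}" using i lp by simp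
  have "{q ! j, q ! Suc j} \<in> G" if "Suc j < length q" for j
  proof -
    have "{q ! j, q ! Suc j} \<noteq> {q ! (l - 1), q ! 0}"
    proof
      assume "{q ! j, q ! Suc j} = {q ! (l - 1), q ! 0}"
      \<comment> \<open>Vertices of a cycle are distinct, so an earlier edge equals the closing one
        only if \<open>l = 2\<close>, which is excluded by \<open>len\<close>.\<close>
      then have "j = l - 1 \<or> j = 0 \<and> Suc j = l - 1"
        using len that nth_eq_iff_index_eq[OF d, of j 0] nth_eq_iff_index_eq[OF d, of j "l - 1"]
          nth_eq_iff_index_eq[OF d, of "Suc j" "l - 1"]
        unfolding doubleton_eq_iff l_def by force
      then show False using len that by (auto simp: l_def)
    qed
    then show ?thesis using e[of j] that uv by (auto simp: l_def)
  qed
  then have "conn G (q ! 0) (q ! (l - 1))"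
    using path_imp_conn[of q G "l - 1"] len by (auto simp: l_def)
  then have "conn G u v" using uv conn_sym by (metis doubleton_eq_iff)
  then show False using nc by simp
qed

section \<open>Counting components when an edge is added\<close>

abbreviation comp_of :: "'a set \<Rightarrow> 'a set set \<Rightarrow> 'a \<Rightarrow> 'a set" where
  "comp_of V E x \<equiv> {y \<in> V. conn E x y}"

lemma graph_components_eq: "graph_components V E = comp_of V E ` V"
  unfolding graph_components_def quotient_def by (auto simp flip: conn_def)

lemma comp_of_eq_iff: "y \<in> V \<Longrightarrow> comp_of V E x = comp_of V E y \<longleftrightarrow> conn E x y"
  using conn_sym conn_trans conn_refl by (smt (verit) Collect_cong mem_Collect_eq)

text \<open>The components of \<open>u\<close> and \<open>v\<close> merge into one and the others,
  collected in \<open>?R\<close>, are unchanged: \<open>card ?R + 2\<close> components become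
  \<open>card ?R + 1\<close>.\<close>

lemma card_graph_components_insert:
  assumes "finite V" "u \<in> V" "v \<in> V" and nc: "\<not> conn G u v"
  shows "card (graph_components V G) = Suc (card (graph_components V (insert {u, v} G)))"
proof -
  let ?c = "comp_of V G" and ?d = "comp_of V (insert {u, v} G)"
  let ?R = "?c ` V - {?c u, ?c v}"
  have d: "?d x = (if conn G x u \<or> conn G x v then ?c u \<union> ?c v else ?c x)" for x
    unfolding conn_insert by (auto intro: conn_sym conn_trans)
  have R: "?R = ?c ` {x \<in> V. \<not> conn G x u \<and> \<not> conn G x v}"
    using assms(2,3) comp_of_eq_iff[of _ V G] by blast
  have "?d ` V = insert (?c u \<union> ?c v) ?R"
    unfolding R d using assms(2) by (auto simp: image_iff)
  moreover have "?c u \<union> ?c v \<notin> ?R"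
  proof
    assume "?c u \<union> ?c v \<in> ?R"
    then obtain x where x: "?c u \<union> ?c v = ?c x" by blast
    have "u \<in> ?c u \<union> ?c v" "v \<in> ?c u \<union> ?c v" using assms by auto
    then show False unfolding x using nc conn_sym conn_trans by (metis (mono_tags, lifting) mem_Collect_eq)
  qed
  moreover have "finite ?R" using assms(1) by auto
  ultimately have "card (?d ` V) = Suc (card ?R)" by simp
  have "?c u \<noteq> ?c v" using nc assms(3) comp_of_eq_iff by metis
  have two: "card (insert a (insert b R)) = Suc (Suc (card R))"
    if "finite R" "a \<notin> R" "b \<notin> R" "a \<noteq> b" for a b and R :: "'a set set"
    using that by simp
  have eq: "?c ` V = insert (?c u) (insert (?c v) ?R)" using assms by blast
  have "?c u \<notin> ?R" "?c v \<notin> ?R" by blast+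
  then have "card (?c ` V) = Suc (Suc (card ?R))"
    by (rule trans[OF arg_cong[where f = card, OF eq] two[OF \<open>finite ?R\<close> _ _ \<open>?c u \<noteq> ?c v\<close>]])
  with \<open>card (?d ` V) = Suc (card ?R)\<close> show ?thesis by (simp add: graph_components_eq)
qed

lemma insert_in_forests_iff:
  assumes "finite V" "u \<in> V" "v \<in> V" "u \<noteq> v" "{u, v} \<notin> G"
  shows "insert {u, v} G \<in> forests V k \<longleftrightarrow> G \<in> forests V (Suc k) \<and> \<not> conn G u v"
proof -
  have "{u, v} \<in> all_edges V" using assms by (auto simp: all_edges_def)
  moreover have "is_forest (insert {u, v} G) \<longleftrightarrow> is_forest G \<and> \<not> conn G u v"
    using assms not_conn_if_insert_forest is_forest_insert is_forest_mono by (metis subset_insertI)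
  ultimately show ?thesis
    using card_graph_components_insert[OF assms(1-3), of G] by (auto simp: forests_def)
qed

text \<open>Deleting both edges is a bijection with inverse adding them back; each deletion raises
  the number of components by one.\<close>

lemma card_forests_with_two_edges:
  assumes "finite V" "u \<in> V" "v \<in> V" "u \<noteq> v" "w \<in> V" "x \<in> V" "w \<noteq> x" "{u, v} \<noteq> {w, x}"
  shows "card {F \<in> forests V k. {u, v} \<in> F \<and> {w, x} \<in> F} =
    card {G \<in> forests V (k + 2). \<not> conn G u v \<and> \<not> conn (insert {u, v} G) w x}"
    (is "card ?A = card ?B")
proof -
  \<comment> \<open>The separation conditions keep both edges out of \<open>G\<close>, so deletion
    really undoes insertion.\<close>
  have new: "{u, v} \<notin> G \<and> {w, x} \<notin> G"
    if "\<not> conn G u v" "\<not> conn (insert {u, v} G) w x" for G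
    using that conn_edge conn_insert by metis
  have iff: "insert {w, x} (insert {u, v} G) \<in> forests V k \<longleftrightarrow> G \<in> ?B"
    if "{u, v} \<notin> G" "{w, x} \<notin> G" for G
    using insert_in_forests_iff[of V w x "insert {u, v} G" k] insert_in_forests_iff[of V u v G "Suc k"]
      assms that by auto
  have "bij_betw (\<lambda>G. insert {w, x} (insert {u, v} G)) ?B ?A"
  proof (rule bij_betw_byWitness[where f' = "\<lambda>F. F - {{u, v}, {w, x}}"])
    show "\<forall>G\<in>?B. insert {w, x} (insert {u, v} G) - {{u, v}, {w, x}} = G"
      using new by auto
    show "\<forall>F\<in>?A. insert {w, x} (insert {u, v} (F - {{u, v}, {w, x}})) = F"
      by auto
    show "(\<lambda>G. insert {w, x} (insert {u, v} G)) ` ?B \<subseteq> ?A"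
      using new iff by auto
    show "(\<lambda>F. F - {{u, v}, {w, x}}) ` ?A \<subseteq> ?B"
    proof (rule image_subsetI)
      fix F assume F: "F \<in> ?A"
      then have "insert {w, x} (insert {u, v} (F - {{u, v}, {w, x}})) = F" by auto
      then show "F - {{u, v}, {w, x}} \<in> ?B"
        using iff[of "F - {{u, v}, {w, x}}"] F by (metis (no_types, lifting) Diff_iff insertCI mem_Collect_eq)
    qed
  qed
  then show ?thesis using bij_betw_same_card by fastforce
qed

lemma finite_forests: "finite V \<Longrightarrow> finite (forests V k)"
  by (rule finite_subset[of _ "Pow (Pow V)"]) (auto simp: forests_def all_edges_def)

subsection \<open>Relabelling invariance\<close>

text \<open>Images of walks are walks; the converse is the same fact for the inverse of
  \<open>f\<close>.\<close>

lemma conn_image: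
  fixes f :: "'a \<Rightarrow> 'a"
  assumes "bij f"
  shows "conn ((`) f ` E) (f x) (f y) \<longleftrightarrow> conn E x y"
proof -
  have 1: "conn ((`) f ` E) (f x) (f y)" if "conn E x y" for f :: "'a \<Rightarrow> 'a" and E x y
    using that unfolding conn_def
  proof (induction rule: rtrancl_induct)
    case (step y z)
    have "{f y, f z} \<in> (`) f ` E" using step by (auto intro!: image_eqI[of _ _ "{y, z}"])
    then show ?case using step by (auto intro: rtrancl_into_rtrancl)
  qed auto
  have "(`) (inv_into UNIV f) ` (`) f ` E = E"
    using assms by (simp add: image_image bij_is_inj)
  then show ?thesis using 1[of E x y f] 1[of "(`) f ` E" "f x" "f y" "inv_into UNIV f"] assms
    by (auto simp: bij_is_inj)
qed

lemma is_forest_image: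
  assumes "bij f" "is_forest E"
  shows "is_forest ((`) f ` E)"
  unfolding is_forest_def
proof
  assume "\<exists>p. is_cycle ((`) f ` E) p"
  then obtain p where p: "is_cycle ((`) f ` E) p" by blast
  have "is_cycle E (map (inv_into UNIV f) p)"
    unfolding is_cycle_def
  proof (intro conjI allI impI)
    show "3 \<le> length (map (inv_into UNIV f) p)" using p by (simp add: is_cycle_def)
    have "inj (inv_into UNIV f)" using assms(1) by (simp add: bij_imp_bij_inv bij_is_inj)
    then show "distinct (map (inv_into UNIV f) p)" using p
      by (auto simp: is_cycle_def distinct_map intro: inj_on_subset)
    fix i assume i: "i < length (map (inv_into UNIV f) p)"
    then have "{p ! i, p ! ((i + 1) mod length p)} \<in> (`) f ` E" using p by (simp add: is_cycle_def)
    then obtain e where e: "e \<in> E" "{p ! i, p ! ((i + 1) mod length p)} = f ` e" by auto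
    have "inv_into UNIV f ` {p ! i, p ! ((i + 1) mod length p)} = e"
      unfolding e(2) using assms by (simp add: image_comp bij_is_inj)
    moreover have "(i + 1) mod length p < length p" using i by (auto intro: mod_less_divisor)
    ultimately show "{map (inv_into UNIV f) p ! i, map (inv_into UNIV f) p ! ((i + 1) mod length (map (inv_into UNIV f) p))} \<in> E"
      using e i by simp
  qed
  then show False using assms by (auto simp: is_forest_def)
qed

lemma forests_image:
  assumes f: "f permutes V" and F: "F \<in> forests V k"
  shows "(`) f ` F \<in> forests V k"
proof -
  have b: "bij f" using f permutes_bij by blast
  have "comp_of V ((`) f ` F) ` V = (`) f ` comp_of V F ` V"
  proof -
    have "comp_of V ((`) f ` F) (f x) = f ` comp_of V F x" for x
    proof -
      have "comp_of V ((`) f ` F) (f x) = {y \<in> f ` V. conn ((`) f ` F) (f x) y}"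
        using f by (simp add: permutes_image)
      also have "\<dots> = f ` comp_of V F x" using conn_image[OF b] by auto
      finally show ?thesis .
    qed
    then have "comp_of V ((`) f ` F) ` f ` V = (`) f ` comp_of V F ` V"
      by (simp add: image_image)
    then show ?thesis using f by (simp add: permutes_image)
  qed
  then have "card (graph_components V ((`) f ` F)) = card (graph_components V F)"
    unfolding graph_components_eq
    using card_image[OF inj_on_image[OF inj_on_subset[OF bij_is_inj[OF b]]], of "comp_of V F ` V"]
    by simp
  moreover have "(`) f ` F \<subseteq> all_edges V"
  proof (rule image_subsetI)
    fix e assume "e \<in> F"
    then have "e \<subseteq> V" "card e = 2" using F by (auto simp: forests_def all_edges_def)
    then show "f ` e \<in> all_edges V"
      using permutes_image[OF f] card_image[OF inj_on_subset[OF bij_is_inj[OF b]], of e]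
      by (auto simp: all_edges_def)
  qed
  ultimately show ?thesis using F is_forest_image[OF b] by (simp add: forests_def)
qed

text \<open>Pulling forests back along \<open>f\<close> is the bijection. Leaving \<open>Q\<close>
  an arbitrary property of the connectivity relation covers all patterns at once.\<close>

lemma card_forests_permute:
  assumes "finite V" and f: "f permutes V"
  shows "card {G \<in> forests V k. Q (\<lambda>x y. conn G (f x) (f y))} = card {G \<in> forests V k. Q (conn G)}"
proof -
  have b: "bij f" and bi: "bij (inv_into UNIV f)" using f permutes_bij permutes_inv by blast+
  have i1: "(`) (inv_into UNIV f) ` (`) f ` E = E" for E
    using b by (simp add: image_image bij_is_inj)
  have i2: "(`) f ` (`) (inv_into UNIV f) ` E = E" for E
    using b by (simp add: image_image bij_is_surj surj_f_inv_f)
  have c: "conn ((`) f ` G) (f x) (f y) = conn G x y" for G x y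
    using conn_image[OF b] .
  have c': "conn ((`) (inv_into UNIV f) ` G) x y = conn G (f x) (f y)" for G x y
    using conn_image[OF b, of "(`) (inv_into UNIV f) ` G" x y] i2 by simp
  have c'': "conn ((`) (inv_into UNIV f) ` G) = (\<lambda>x y. conn G (f x) (f y))" for G
    by (intro ext c')
  have "bij_betw ((`) ((`) (inv_into UNIV f))) {G \<in> forests V k. Q (\<lambda>x y. conn G (f x) (f y))} {G \<in> forests V k. Q (conn G)}"
    by (rule bij_betw_byWitness[where f' = "(`) ((`) f)"])
      (use i1 i2 c c'' forests_image[OF f] forests_image[OF permutes_inv[OF f]] in auto)
  then show ?thesis using bij_betw_same_card by blast
qed

lemma ex_permutes_extending:
  assumes "finite V" "inj_on g A" "A \<subseteq> V" "g ` A \<subseteq> V"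
  obtains f where "f permutes V" "\<And>x. x \<in> A \<Longrightarrow> f x = g x"
proof -
  have "card (V - A) = card (V - g ` A)"
    using assms by (simp add: card_Diff_subset finite_subset card_image)
  then obtain h where h: "bij_betw h (V - A) (V - g ` A)"
    using assms(1) by (meson finite_Diff finite_same_card_bij)
  define f where "f x = (if x \<in> A then g x else if x \<in> V then h x else x)" for x
  have "bij_betw f A (g ` A)"
    using assms(2) by (auto simp: bij_betw_def f_def inj_on_def)
  moreover have "bij_betw f (V - A) (V - g ` A)"
    using h by (rule bij_betw_cong[THEN iffD1, rotated]) (auto simp: f_def)
  ultimately have "bij_betw f (A \<union> (V - A)) (g ` A \<union> (V - g ` A))"
    by (rule bij_betw_combine) auto
  moreover have "A \<union> (V - A) = V" "g ` A \<union> (V - g ` A) = V" using assms by auto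
  ultimately have "f permutes V"
    by (intro bij_imp_permutes) (use assms in \<open>auto simp: f_def\<close>)
  then show ?thesis using that f_def by auto
qed

text \<open>Some permutation of \<open>V\<close> carries one quadruple to the other, so the count
  depends only on the pattern \<open>Q\<close> of the six pairwise connections.\<close>

lemma card_forests_four_points:
  assumes "finite V" and "distinct [s, t, y, z]" "{s, t, y, z} \<subseteq> V"
    and "distinct [s', t', y', z']" "{s', t', y', z'} \<subseteq> V"
  shows "card {G \<in> forests V m. Q (conn G s t) (conn G s y) (conn G s z) (conn G t y) (conn G t z) (conn G y z)} =
    card {G \<in> forests V m. Q (conn G s' t') (conn G s' y') (conn G s' z') (conn G t' y') (conn G t' z') (conn G y' z')}"
proof -
  define g where "g = (\<lambda>x. if x = s then s' else if x = t then t' else if x = y then y' else z')"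
  have "inj_on g {s, t, y, z}" "g ` {s, t, y, z} \<subseteq> V"
    using assms by (auto simp: g_def inj_on_def)
  then obtain f where f: "f permutes V" "\<And>x. x \<in> {s, t, y, z} \<Longrightarrow> f x = g x"
    using ex_permutes_extending[OF assms(1)] assms(3) by metis
  have "f s = s'" "f t = t'" "f y = y'" "f z = z'"
    using f(2) assms(2) by (auto simp: g_def)
  then show ?thesis
    using card_forests_permute[OF assms(1) f(1), of m "\<lambda>c. Q (c s t) (c s y) (c s z) (c t y) (c t z) (c y z)"]
    by simp
qed

subsection \<open>Counting forests through two given edges\<close>

text \<open>For an equivalence relation this is the partition \<open>s t | y | z\<close>: given
  \<open>c s t\<close>, whatever is separated from \<open>s\<close> is separated from
  \<open>t\<close>.\<close>

definition one_pair :: "('a \<Rightarrow> 'a \<Rightarrow> bool) \<Rightarrow> 'a \<Rightarrow> 'a \<Rightarrow> 'a \<Rightarrow> 'a \<Rightarrow> bool" where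
  "one_pair c s t y z \<longleftrightarrow> c s t \<and> \<not> c s y \<and> \<not> c s z \<and> \<not> c y z"

definition no_pair :: "('a \<Rightarrow> 'a \<Rightarrow> bool) \<Rightarrow> 'a \<Rightarrow> 'a \<Rightarrow> 'a \<Rightarrow> 'a \<Rightarrow> bool" where
  "no_pair c s t y z \<longleftrightarrow>
    \<not> c s t \<and> \<not> c s y \<and> \<not> c s z \<and> \<not> c t y \<and> \<not> c t z \<and> \<not> c y z"

lemma card_forests_one_pair:
  assumes "finite V" and "distinct [s, t, y, z]" "{s, t, y, z} \<subseteq> V"
    and "distinct [s', t', y', z']" "{s', t', y', z'} \<subseteq> V"
  shows "card {G \<in> forests V m. one_pair (conn G) s t y z} =
    card {G \<in> forests V m. one_pair (conn G) s' t' y' z'}"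
  unfolding one_pair_def
  using card_forests_four_points[OF assms, of m "\<lambda>a b c d e f. a \<and> \<not> b \<and> \<not> c \<and> \<not> f"] .

lemma card_forests_no_pair:
  assumes "finite V" and "distinct [s, t, y, z]" "{s, t, y, z} \<subseteq> V"
    and "distinct [s', t', y', z']" "{s', t', y', z'} \<subseteq> V"
  shows "card {G \<in> forests V m. no_pair (conn G) s t y z} =
    card {G \<in> forests V m. no_pair (conn G) s' t' y' z'}"
  unfolding no_pair_def
  using card_forests_four_points[OF assms,
      of m "\<lambda>a b c d e f. \<not> a \<and> \<not> b \<and> \<not> c \<and> \<not> d \<and> \<not> e \<and> \<not> f"] .

text \<open>Both edges can be added exactly when \<open>u\<close>, \<open>v\<close>,
  \<open>w\<close> lie in three components. The auxiliary vertex \<open>x\<close> is then in a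
  component apart from these or in one of the three, which makes the count comparable with that for
  disjoint edges.\<close>

lemma adjacent_edges_addable_iff:
  "\<not> conn G u v \<and> \<not> conn (insert {u, v} G) v w \<longleftrightarrow>
    no_pair (conn G) u v w x \<or> one_pair (conn G) x u v w \<or>
    one_pair (conn G) x v u w \<or> one_pair (conn G) x w u v"
  unfolding conn_insert no_pair_def one_pair_def
  using conn_sym[of G] conn_trans[of G] conn_refl[of G] by (smt (verit))

text \<open>At most one of the four cross pairs between \<open>{u, v}\<close> and
  \<open>{w, x}\<close> may be connected: two of them would connect an edge's endpoints or close a
  cycle through both edges.\<close>

lemma disjoint_edges_addable_iff:
  "\<not> conn G u v \<and> \<not> conn (insert {u, v} G) w x \<longleftrightarrow>
    no_pair (conn G) u v w x \<or> one_pair (conn G) u w v x \<or> one_pair (conn G) u x v w \<or>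
    one_pair (conn G) v w u x \<or> one_pair (conn G) v x u w"
  unfolding conn_insert no_pair_def one_pair_def
  using conn_sym[of G] conn_trans[of G] conn_refl[of G] by (smt (verit))

lemma card_forests_disj:
  assumes "finite V" and "\<And>G. \<not> (P G \<and> Q G)"
  shows "card {G \<in> forests V m. P G \<or> Q G} =
    card {G \<in> forests V m. P G} + card {G \<in> forests V m. Q G}"
proof -
  have "{G \<in> forests V m. P G \<or> Q G} = {G \<in> forests V m. P G} \<union> {G \<in> forests V m. Q G}"
    by blast
  then show ?thesis
    using assms finite_forests[OF assms(1), of m] by (auto intro!: card_Un_disjoint)
qed

lemma card_forests_adjacent_edges:
  assumes V: "finite V" and d: "distinct [u, v, w, x]" and sub: "{u, v, w, x} \<subseteq> V"
  shows "card {F \<in> forests V k. {u, v} \<in> F \<and> {v, w} \<in> F} =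
    card {G \<in> forests V (k + 2). no_pair (conn G) u v w x} +
    3 * card {G \<in> forests V (k + 2). one_pair (conn G) u v w x}"
proof -
  let ?p = "\<lambda>s t y z. card {G \<in> forests V (k + 2). one_pair (conn G) s t y z}"
  let ?q = "card {G \<in> forests V (k + 2). no_pair (conn G) u v w x}"
  have "card {F \<in> forests V k. {u, v} \<in> F \<and> {v, w} \<in> F} =
    card {G \<in> forests V (k + 2). no_pair (conn G) u v w x \<or> one_pair (conn G) x u v w \<or>
      one_pair (conn G) x v u w \<or> one_pair (conn G) x w u v}"
    using card_forests_with_two_edges[of V u v v w k] assms
    by (auto simp: adjacent_edges_addable_iff[of _ u v w x] doubleton_eq_iff)
  also have "\<dots> = ?q + (?p x u v w + (?p x v u w + ?p x w u v))"
    \<comment> \<open>The patterns exclude each other, so the count of the disjunction is a sum;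
      relabelling then identifies all \<open>one_pair\<close> counts.\<close>
    by (subst card_forests_disj, fact V,
        metis no_pair_def one_pair_def conn_sym conn_trans)+ simp
  also have "?p x u v w = ?p u v w x" using assms by (intro card_forests_one_pair) auto
  also have "?p x v u w = ?p u v w x" using assms by (intro card_forests_one_pair) auto
  also have "?p x w u v = ?p u v w x" using assms by (intro card_forests_one_pair) auto
  finally show ?thesis by simp
qed

lemma card_forests_disjoint_edges:
  assumes V: "finite V" and d: "distinct [u, v, w, x]" and sub: "{u, v, w, x} \<subseteq> V"
  shows "card {F \<in> forests V k. {u, v} \<in> F \<and> {w, x} \<in> F} =
    card {G \<in> forests V (k + 2). no_pair (conn G) u v w x} +
    4 * card {G \<in> forests V (k + 2). one_pair (conn G) u v w x}"
proof -
  let ?p = "\<lambda>s t y z. card {G \<in> forests V (k + 2). one_pair (conn G) s t y z}"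
  let ?q = "card {G \<in> forests V (k + 2). no_pair (conn G) u v w x}"
  have "card {F \<in> forests V k. {u, v} \<in> F \<and> {w, x} \<in> F} =
    card {G \<in> forests V (k + 2). no_pair (conn G) u v w x \<or> one_pair (conn G) u w v x \<or>
      one_pair (conn G) u x v w \<or> one_pair (conn G) v w u x \<or> one_pair (conn G) v x u w}"
    using card_forests_with_two_edges[of V u v w x k] assms
    by (auto simp: disjoint_edges_addable_iff doubleton_eq_iff)
  also have "\<dots> = ?q + (?p u w v x + (?p u x v w + (?p v w u x + ?p v x u w)))"
    by (subst card_forests_disj, fact V,
        metis no_pair_def one_pair_def conn_sym conn_trans)+ simp
  also have "?p u w v x = ?p u v w x" using assms by (intro card_forests_one_pair) auto
  also have "?p u x v w = ?p u v w x" using assms by (intro card_forests_one_pair) auto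
  also have "?p v w u x = ?p u v w x" using assms by (intro card_forests_one_pair) auto
  also have "?p v x u w = ?p u v w x" using assms by (intro card_forests_one_pair) auto
  finally show ?thesis by simp
qed

section \<open>Existence of a separating forest and the two counts\<close>

lemma conn_empty [simp]: "conn {} x y \<longleftrightarrow> x = y"
  by (simp add: conn_def)

lemma empty_in_forests: "{} \<in> forests V (card V)"
proof -
  have "card ((\<lambda>x. {y. y \<in> V \<and> x = y}) ` V) = card V"
    by (rule card_image) (auto simp: inj_on_def)
  moreover have "is_forest {}" by (auto simp: is_forest_def is_cycle_def intro!: exI[of _ 0])
  ultimately show ?thesis by (simp add: forests_def graph_components_eq)
qed

text \<open>Start from the edgeless forest and lower the number of components one by one, always
  attaching to \<open>u\<close> a component that contains none of \<open>u\<close>,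
  \<open>v\<close>, \<open>w\<close>.\<close>

lemma ex_forest_separating_three:
  assumes V: "finite V" and d: "distinct [u, v, w]" and sub: "{u, v, w} \<subseteq> V"
    and "m \<le> card V" "3 \<le> m"
  shows "\<exists>G \<in> forests V m. \<not> conn G u v \<and> \<not> conn G v w \<and> \<not> conn G u w"
  using assms(4,5)
proof (induction rule: inc_induct)
  case base
  then show ?case using empty_in_forests[of V] d by (intro bexI[of _ "{}"]) auto
next
  case (step m)
  then obtain G where G: "G \<in> forests V (Suc m)"
    and nc: "\<not> conn G u v" "\<not> conn G v w" "\<not> conn G u w" by auto
  let ?c = "comp_of V G"
  \<comment> \<open>There are \<open>Suc m\<close>, hence at least four, components and the three
    vertices occupy only three.\<close>
  have "card {?c u, ?c v, ?c w} \<le> 3"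
    by (simp add: card_insert_if)
  moreover have "card (?c ` V) \<ge> 4" using G step by (simp add: forests_def graph_components_eq)
  ultimately have "\<not> ?c ` V \<subseteq> {?c u, ?c v, ?c w}"
    using card_mono[of "{?c u, ?c v, ?c w}" "?c ` V"] by auto
  then obtain x where x: "x \<in> V" "?c x \<notin> {?c u, ?c v, ?c w}" by blast
  then have nx: "\<not> conn G u x" "\<not> conn G v x" "\<not> conn G w x"
    using comp_of_eq_iff[OF x(1), of G] by auto
  then have "u \<noteq> x" "{u, x} \<notin> G" using conn_edge by (metis conn_refl, metis)
  then have "insert {u, x} G \<in> forests V m"
    using insert_in_forests_iff[of V u x G m] V sub x G nx by auto
  moreover have "\<not> conn (insert {u, x} G) u v" "\<not> conn (insert {u, x} G) v w"
    "\<not> conn (insert {u, x} G) u w"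
    unfolding conn_insert using nc nx conn_sym by metis+
  ultimately show ?case by blast
qed

lemma forest_edge_pair_counts:
  fixes V :: "'a set"
  assumes V: "finite V" and "4 \<le> card V" "0 < k" "k + 2 \<le> card V"
  shows "\<exists>p q. 0 < q + p \<and>
    (\<forall>u v w. distinct [u, v, w] \<longrightarrow> {u, v, w} \<subseteq> V \<longrightarrow>
      card {F \<in> forests V k. {u, v} \<in> F \<and> {v, w} \<in> F} = q + 3 * p) \<and>
    (\<forall>u v w x. distinct [u, v, w, x] \<longrightarrow> {u, v, w, x} \<subseteq> V \<longrightarrow>
      card {F \<in> forests V k. {u, v} \<in> F \<and> {w, x} \<in> F} = q + 4 * p)"
proof -
  have ex: "\<exists>x \<in> V. x \<notin> set xs" if "length xs < 4" for xs :: "'a list"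
  proof (rule ccontr)
    assume "\<not> ?thesis"
    then have "V \<subseteq> set xs" by blast
    then have "card V \<le> length xs" by (meson card_length card_mono finite_set le_trans)
    then show False using that assms(2) by simp
  qed
  obtain s where s: "s \<in> V" using ex[of "[]"] by auto
  obtain t where t: "t \<in> V" "t \<noteq> s" using ex[of "[s]"] by auto
  obtain y where y: "y \<in> V" "y \<noteq> s" "y \<noteq> t" using ex[of "[s, t]"] by auto
  obtain z where z: "z \<in> V" "z \<noteq> s" "z \<noteq> t" "z \<noteq> y" using ex[of "[s, t, y]"] by auto
  have base: "distinct [s, t, y, z]" "{s, t, y, z} \<subseteq> V" using s t y z by auto
  define p where "p = card {G \<in> forests V (k + 2). one_pair (conn G) s t y z}"
  define q where "q = card {G \<in> forests V (k + 2). no_pair (conn G) s t y z}"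
  have adj: "card {F \<in> forests V k. {u, v} \<in> F \<and> {v, w} \<in> F} = q + 3 * p"
    if uvw: "distinct [u, v, w]" "{u, v, w} \<subseteq> V" for u v w
  proof -
    \<comment> \<open>A fourth vertex, available since \<open>4 \<le> card V\<close>, brings in the
      four-point counts.\<close>
    obtain x where x: "x \<in> V" "x \<notin> {u, v, w}" using ex[of "[u, v, w]"] by auto
    have d: "distinct [u, v, w, x]" "{u, v, w, x} \<subseteq> V" using uvw x by auto
    show ?thesis
      unfolding card_forests_adjacent_edges[OF V d] p_def q_def
      using card_forests_one_pair[OF V d base] card_forests_no_pair[OF V d base] by simp
  qed
  have disj: "card {F \<in> forests V k. {u, v} \<in> F \<and> {w, x} \<in> F} = q + 4 * p"
    if d: "distinct [u, v, w, x]" "{u, v, w, x} \<subseteq> V" for u v w x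
    unfolding card_forests_disjoint_edges[OF V d] p_def q_def
    using card_forests_one_pair[OF V d base] card_forests_no_pair[OF V d base] by simp
  \<comment> \<open>Since \<open>k > 0\<close>, there are at least three components to separate
    \<open>s\<close>, \<open>t\<close>, \<open>y\<close>. This makes \<open>q + 3 * p\<close>
    positive, hence also \<open>q + p\<close>.\<close>
  have "\<exists>G \<in> forests V (k + 2). \<not> conn G s t \<and> \<not> conn G t y \<and> \<not> conn G s y"
    using ex_forest_separating_three[OF V, of s t y "k + 2"] base assms by auto
  then obtain G where "G \<in> forests V (k + 2)" "\<not> conn G s t" "\<not> conn (insert {s, t} G) t y"
    unfolding conn_insert using conn_sym by blast
  then have "{G \<in> forests V (k + 2). \<not> conn G s t \<and> \<not> conn (insert {s, t} G) t y} \<noteq> {}" by blast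
  then have "card {F \<in> forests V k. {s, t} \<in> F \<and> {t, y} \<in> F} > 0"
    using card_forests_with_two_edges[of V s t t y k] V base finite_forests[OF V, of "k + 2"]
    by (auto simp: card_gt_0_iff doubleton_eq_iff)
  then have "q + p > 0" using adj[of s t y] base by simp
  then show ?thesis using adj disj by (intro exI[of _ p] exI[of _ q] conjI allI impI)
qed

subsection \<open>Matrices with constant row and column sums\<close>

text \<open>
  Adding all rows of \<open>x I - A\<close> to the first one makes that row \<open>x - l\<close> times the all-ones row.
  So the characteristic polynomial is \<open>x - l\<close> times the determinant of the matrix with first row
  all ones, whose kernel at \<open>x = l\<close> consists of the \<open>l\<close>-eigenvectors with coordinate sum zero.
\<close>

lemma order_char_poly_const_col_sums:
  fixes A :: "real mat"
  assumes A: "A \<in> carrier_mat m m" and m: "0 < m"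
    and cols: "\<And>j. j < m \<Longrightarrow> (\<Sum>i<m. A $$ (i, j)) = l"
    and simple: "\<And>v. v \<in> carrier_vec m \<Longrightarrow> A *\<^sub>v v = l \<cdot>\<^sub>v v \<Longrightarrow> (\<Sum>i<m. v $ i) = 0 \<Longrightarrow> v = 0\<^sub>v m"
  shows "Polynomial.order l (char_poly A) = 1"
proof -
  let ?C = "char_poly_matrix A"
  \<comment> \<open>Left multiplication by \<open>L\<close> adds all rows to the first; left
    multiplication by \<open>D\<close> scales the first row by \<open>x - l\<close>.\<close>
  define L :: "real poly mat" where "L = mat m m (\<lambda>(i, j). if i = 0 \<or> i = j then 1 else 0)"
  define D :: "real poly mat" where
    "D = mat m m (\<lambda>(i, j). if i = j then if i = 0 then [:-l, 1:] else 1 else 0)"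
  define M where "M = mat m m (\<lambda>(i, j). if i = 0 then 1 else ?C $$ (i, j))"
  have carr: "L \<in> carrier_mat m m" "D \<in> carrier_mat m m" "M \<in> carrier_mat m m" "?C \<in> carrier_mat m m"
    using A by (auto simp: L_def D_def M_def)
  have C: "?C $$ (i, j) = (if i = j then [:0, 1:] else 0) - [:A $$ (i, j):]" if "i < m" "j < m" for i j
    using A that by (simp add: char_poly_matrix_def)
  have "L * ?C = D * M"
  proof (rule eq_matI)
    fix i j assume "i < dim_row (D * M)" "j < dim_col (D * M)"
    then have ij: "i < m" "j < m" using carr by auto
    have "(L * ?C) $$ (i, j) = (\<Sum>k<m. L $$ (i, k) * ?C $$ (k, j))"
      using ij carr by (auto simp: scalar_prod_def lessThan_atLeast0)
    also have "\<dots> = (if i = 0 then [:-l, 1:] else ?C $$ (i, j))"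
    proof (cases "i = 0")
      case True
      have "(\<Sum>k<m. L $$ (i, k) * ?C $$ (k, j)) = (\<Sum>k<m. ?C $$ (k, j))"
        using True ij by (intro sum.cong) (auto simp: L_def)
      also have "\<dots> = (\<Sum>k<m. if k = j then [:0, 1:] else 0) - (\<Sum>k<m. [:A $$ (k, j):])"
        using ij C by (simp add: sum_subtractf)
      also have "(\<Sum>k<m. [:A $$ (k, j):]) = [:\<Sum>k<m. A $$ (k, j):]"
        by (induction m) auto
      finally show ?thesis using True ij cols by simp
    next
      case False
      have "(\<Sum>k<m. L $$ (i, k) * ?C $$ (k, j)) = (\<Sum>k<m. if k = i then ?C $$ (k, j) else 0)"
        using False ij by (intro sum.cong) (auto simp: L_def)
      then show ?thesis using False ij by simp
    qed
    also have "\<dots> = (\<Sum>k<m. if k = i then D $$ (i, i) * M $$ (i, j) else 0)"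
      using ij by (simp add: D_def M_def)
    also have "\<dots> = (\<Sum>k<m. D $$ (i, k) * M $$ (k, j))"
      using ij by (intro sum.cong) (auto simp: D_def)
    also have "\<dots> = (D * M) $$ (i, j)"
      using ij carr by (auto simp: scalar_prod_def lessThan_atLeast0)
    finally show "(L * ?C) $$ (i, j) = (D * M) $$ (i, j)" .
  qed (use carr in auto)
  then have "det L * det ?C = det D * det M"
    using carr det_mult by metis
  moreover have "det L = 1"
  proof -
    have "det L = prod_list (diag_mat L)"
      using carr by (intro det_upper_triangular) (auto simp: L_def)
    moreover have "diag_mat L = replicate m 1"
      by (rule nth_equalityI) (auto simp: diag_mat_def L_def)
    ultimately show ?thesis by simp
  qed
  moreover have "det D = [:-l, 1:]"
  proof -
    have "det D = prod_list (diag_mat D)"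
      using carr by (intro det_upper_triangular) (auto simp: D_def)
    moreover have "diag_mat D = [:-l, 1:] # replicate (m - 1) 1"
      using m by (intro nth_equalityI) (auto simp: diag_mat_def D_def nth_Cons')
    ultimately show ?thesis by simp
  qed
  ultimately have cp: "char_poly A = [:-l, 1:] * det M" by (simp add: char_poly_def)
  \<comment> \<open>If \<open>M\<close> evaluated at \<open>l\<close> is nonsingular, then
    \<open>l\<close> is no root of \<open>det M\<close>, so the split-off linear factor accounts for
    the whole multiplicity.\<close>
  define N where "N = map_mat (\<lambda>p. poly p l) M"
  have N: "N \<in> carrier_mat m m" using carr by (simp add: N_def)
  have "poly (det M) l = det N"
    using carr by (intro poly_det_cong[OF N]) (auto simp: N_def)
  moreover have "det N \<noteq> 0"
  proof
    assume "det N = 0"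
    then obtain v where v: "v \<in> carrier_vec m" "v \<noteq> 0\<^sub>v m" "N *\<^sub>v v = 0\<^sub>v m"
      using det_0_iff_vec_prod_zero[OF N] by blast
    have Nv: "(\<Sum>j<m. N $$ (i, j) * v $ j) = 0" if "i < m" for i
    proof -
      have "(N *\<^sub>v v) $ i = (\<Sum>j<m. N $$ (i, j) * v $ j)"
        using that N v(1) by (auto simp: scalar_prod_def lessThan_atLeast0)
      then show ?thesis using v(3) that by simp
    qed
    have Av: "(A *\<^sub>v v) $ i = (\<Sum>j<m. A $$ (i, j) * v $ j)" if "i < m" for i
      using that A v(1) by (auto simp: scalar_prod_def lessThan_atLeast0)
    \<comment> \<open>The all-ones row forces a kernel vector to have coordinate sum zero; the other
      rows give the eigenvector equation except at coordinate \<open>0\<close>.\<close>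
    have "(\<Sum>j<m. N $$ (0, j) * v $ j) = (\<Sum>j<m. v $ j)"
      using m by (intro sum.cong) (auto simp: N_def M_def)
    then have s0: "(\<Sum>j<m. v $ j) = 0" using Nv[OF m] by simp
    have row: "(A *\<^sub>v v) $ i = l * v $ i" if i: "i < m" "i \<noteq> 0" for i
    proof -
      have "(\<Sum>j<m. N $$ (i, j) * v $ j) = (\<Sum>j<m. (if j = i then l * v $ j else 0) - A $$ (i, j) * v $ j)"
        using i by (intro sum.cong) (auto simp: N_def M_def C left_diff_distrib)
      also have "\<dots> = l * v $ i - (A *\<^sub>v v) $ i"
        using i Av by (simp add: sum_subtractf)
      finally show ?thesis using Nv i by simp
    qed
    \<comment> \<open>Coordinate \<open>0\<close> is recovered from the column sums: the coordinates
      of \<open>A v - l v\<close> add up to zero and all the others vanish.\<close>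
    have "(\<Sum>i<m. (A *\<^sub>v v) $ i) = (\<Sum>i<m. \<Sum>j<m. A $$ (i, j) * v $ j)"
      using Av by simp
    also have "\<dots> = (\<Sum>j<m. (\<Sum>i<m. A $$ (i, j)) * v $ j)"
      by (subst sum.swap) (simp add: sum_distrib_right)
    also have "\<dots> = l * (\<Sum>j<m. v $ j)" using cols by (simp add: sum_distrib_left)
    finally have "(\<Sum>i<m. (A *\<^sub>v v) $ i - l * v $ i) = 0"
      using s0 by (simp add: sum_subtractf flip: sum_distrib_left)
    also have "(\<Sum>i<m. (A *\<^sub>v v) $ i - l * v $ i) =
      ((A *\<^sub>v v) $ 0 - l * v $ 0) + (\<Sum>i\<in>{..<m} - {0}. (A *\<^sub>v v) $ i - l * v $ i)"
      using m by (subst sum.remove[of _ 0]) auto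
    also have "(\<Sum>i\<in>{..<m} - {0}. (A *\<^sub>v v) $ i - l * v $ i) = 0"
      using row by (intro sum.neutral) auto
    finally have "(A *\<^sub>v v) $ 0 = l * v $ 0" by simp
    then have "(A *\<^sub>v v) $ i = l * v $ i" if "i < m" for i
      using that row by (cases "i = 0") auto
    then have "A *\<^sub>v v = l \<cdot>\<^sub>v v" using A v(1) by (intro eq_vecI) auto
    then show False using simple v s0 by blast
  qed
  ultimately have "poly (det M) l \<noteq> 0" by simp
  then have "Polynomial.order l (det M) = 0" "det M \<noteq> 0" by (auto simp: order_root)
  moreover have "Polynomial.order l [:-l, 1:] = 1"
    using order_power_n_n[of l 1] by simp
  moreover have "[:-l, 1:] * det M \<noteq> 0"
    using \<open>det M \<noteq> 0\<close> by (metis mult_eq_0_iff pCons_eq_0_iff zero_neq_one)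
  ultimately show ?thesis
    unfolding cp using order_mult[of "[:-l, 1:]" "det M" l] by linarith
qed

text \<open>An eigenvector for an eigenvalue other than \<open>l\<close> has coordinate sum zero,
  where the form is negative. So all eigenvalues except \<open>l\<close> are negative, and
  \<open>l\<close> is simple because no eigenvector for it has coordinate sum zero.\<close>

lemma det_and_num_pos_eigenvalues_if_neg_def:
  fixes A :: "real mat"
  assumes A: "A \<in> carrier_mat m m" and m: "0 < m" and l: "0 < l"
    and rows: "\<And>i. i < m \<Longrightarrow> (\<Sum>j<m. A $$ (i, j)) = l"
    and cols: "\<And>j. j < m \<Longrightarrow> (\<Sum>i<m. A $$ (i, j)) = l"
    and neg: "\<And>x. (\<exists>i<m. x i \<noteq> 0) \<Longrightarrow> (\<Sum>i<m. x i) = 0 \<Longrightarrow>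
      (\<Sum>i<m. \<Sum>j<m. x i * A $$ (i, j) * x j) < 0"
  shows "det A \<noteq> 0 \<and> num_pos_eigenvalues A = 1"
proof -
  have Av: "(A *\<^sub>v v) $ i = (\<Sum>j<m. A $$ (i, j) * v $ j)" if "i < m" "v \<in> carrier_vec m" for i v
    using that A by (auto simp: scalar_prod_def lessThan_atLeast0)
  have neg': "\<mu> < 0"
    if v: "v \<in> carrier_vec m" "v \<noteq> 0\<^sub>v m" "A *\<^sub>v v = \<mu> \<cdot>\<^sub>v v" and s: "(\<Sum>i<m. v $ i) = 0" for v \<mu>
  proof -
    have ex: "\<exists>i<m. v $ i \<noteq> 0" using v(1,2) by (metis carrier_vecD eq_vecI index_zero_vec)
    have "(\<Sum>i<m. \<Sum>j<m. v $ i * A $$ (i, j) * v $ j) = (\<Sum>i<m. v $ i * (A *\<^sub>v v) $ i)"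
      using Av v(1) by (simp add: sum_distrib_left mult.assoc)
    also have "\<dots> = \<mu> * (\<Sum>i<m. v $ i * v $ i)"
      unfolding v(3) using v(1) by (simp add: sum_distrib_left mult.left_commute)
    finally have "\<mu> * (\<Sum>i<m. v $ i * v $ i) < 0" using neg[OF ex s] by simp
    moreover have "(\<Sum>i<m. v $ i * v $ i) \<ge> 0" by (intro sum_nonneg) auto
    ultimately show ?thesis by (meson linorder_not_le mult_nonneg_nonneg)
  qed
  have ev: "\<mu> = l \<or> \<mu> < 0" if "v \<in> carrier_vec m" "v \<noteq> 0\<^sub>v m" "A *\<^sub>v v = \<mu> \<cdot>\<^sub>v v" for v \<mu>
  proof -
    \<comment> \<open>Pair the eigenvector equation with the all-ones vector, a left eigenvector by
      the column sums.\<close>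
    have "\<mu> * (\<Sum>i<m. v $ i) = (\<Sum>i<m. (A *\<^sub>v v) $ i)"
      unfolding that(3) using that(1) by (simp add: sum_distrib_left)
    also have "\<dots> = (\<Sum>j<m. (\<Sum>i<m. A $$ (i, j)) * v $ j)"
      using Av that(1) by (simp add: sum_distrib_right) (rule sum.swap)
    also have "\<dots> = l * (\<Sum>j<m. v $ j)" using cols by (simp add: sum_distrib_left)
    finally have "\<mu> = l \<or> (\<Sum>i<m. v $ i) = 0" by auto
    then show ?thesis using neg' that by blast
  qed
  have "eigenvector A (vec m (\<lambda>_. 1)) l"
    unfolding eigenvector_def
  proof (intro conjI)
    show "vec m (\<lambda>_. 1 :: real) \<noteq> 0\<^sub>v (dim_row A)"
    proof
      assume "vec m (\<lambda>_. 1 :: real) = 0\<^sub>v (dim_row A)"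
      then have "vec m (\<lambda>_. 1 :: real) $ 0 = 0\<^sub>v m $ 0" using A by simp
      then show False using m by simp
    qed
    show "A *\<^sub>v vec m (\<lambda>_. 1) = l \<cdot>\<^sub>v vec m (\<lambda>_. 1)"
      using A rows Av[of _ "vec m (\<lambda>_. 1)"] by (intro eq_vecI) auto
  qed (use A in auto)
  then have "eigenvalue A l" by (auto simp: eigenvalue_def)
  then have "{a. eigenvalue A a \<and> a > 0} = {l}"
    using ev l A by (force simp: eigenvalue_def eigenvector_def)
  moreover have "Polynomial.order l (char_poly A) = 1"
    using order_char_poly_const_col_sums[OF A m cols] neg' l by (meson order_less_asym)
  moreover have "det A \<noteq> 0"
  proof
    assume "det A = 0"
    then obtain v where v: "v \<in> carrier_vec m" "v \<noteq> 0\<^sub>v m" "A *\<^sub>v v = 0\<^sub>v m"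
      using det_0_iff_vec_prod_zero[OF A] by blast
    then have "A *\<^sub>v v = 0 \<cdot>\<^sub>v v" by auto
    then show False using ev v l by force
  qed
  ultimately show ?thesis by (simp add: num_pos_eigenvalues_def)
qed

subsection \<open>The Hessian of the forest polynomial\<close>

text \<open>Each product is affine in \<open>x i\<close>. Indexing the products by a family
  \<open>g\<close> lets the rule be applied twice: after one derivative the sum still runs over
  forests \<open>F\<close>, but the products over \<open>F - {e'}\<close>.\<close>

lemma partial_deriv_multilinear:
  fixes g :: "'j \<Rightarrow> 'i set"
  assumes "finite S" and g: "\<And>j. j \<in> S \<Longrightarrow> finite (g j)"
  shows "partial_deriv i (\<lambda>x. \<Sum>j\<in>S. \<Prod>e\<in>g j. x e) =
    (\<lambda>x. \<Sum>j | j \<in> S \<and> i \<in> g j. \<Prod>e\<in>g j - {i}. x e)"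
proof
  fix x :: "'i \<Rightarrow> real"
  have *: "((\<lambda>t. \<Prod>e\<in>g j. (x(i := t)) e) has_field_derivative
      (if i \<in> g j then \<Prod>e\<in>g j - {i}. x e else 0)) (at (x i))" if "j \<in> S" for j
  proof (cases "i \<in> g j")
    case True
    have "(\<Prod>e\<in>g j. (x(i := t)) e) = t * (\<Prod>e\<in>g j - {i}. x e)" for t
      using True g[OF that] by (simp add: prod.remove)
    then show ?thesis using True by (auto intro!: derivative_eq_intros)
  next
    case False
    then have "(\<Prod>e\<in>g j. (x(i := t)) e) = (\<Prod>e\<in>g j. x e)" for t
      by (intro prod.cong) auto
    then show ?thesis using False by simp
  qed
  have "((\<lambda>t. \<Sum>j\<in>S. \<Prod>e\<in>g j. (x(i := t)) e) has_field_derivative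
      (\<Sum>j\<in>S. if i \<in> g j then \<Prod>e\<in>g j - {i}. x e else 0)) (at (x i))"
    by (intro DERIV_sum *)
  then have "partial_deriv i (\<lambda>x. \<Sum>j\<in>S. \<Prod>e\<in>g j. x e) x =
      (\<Sum>j\<in>S. if i \<in> g j then \<Prod>e\<in>g j - {i}. x e else 0)"
    unfolding partial_deriv_def by (rule DERIV_imp_deriv)
  also have "\<dots> = (\<Sum>j | j \<in> S \<and> i \<in> g j. \<Prod>e\<in>g j - {i}. x e)"
    using assms(1) by (rule sum.inter_filter[symmetric])
  finally show "partial_deriv i (\<lambda>x. \<Sum>j\<in>S. \<Prod>e\<in>g j. x e) x = \<dots>" .
qed

lemma finite_all_edges: "finite V \<Longrightarrow> finite (all_edges V)"
  by (rule finite_subset[of _ "Pow V"]) (auto simp: all_edges_def)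

text \<open>The monomials are square-free, which gives the zero diagonal; at the all-ones point
  every surviving monomial counts \<open>1\<close>.\<close>

lemma hessian_forest_poly_entry:
  assumes V: "finite V"
  shows "partial_deriv e (partial_deriv e' (forest_poly V k)) (\<lambda>_. 1) =
    (if e = e' then 0 else real (card {F \<in> forests V k. e \<in> F \<and> e' \<in> F}))"
proof -
  have fin: "finite F" if "F \<in> forests V k" for F
    using that finite_all_edges[OF V] by (auto simp: forests_def intro: finite_subset)
  have "partial_deriv e' (forest_poly V k) =
      (\<lambda>x. \<Sum>F | F \<in> forests V k \<and> e' \<in> F. \<Prod>d\<in>F - {e'}. x d)"
    unfolding forest_poly_def using finite_forests[OF V] fin by (rule partial_deriv_multilinear)
  moreover have "partial_deriv e (\<lambda>x. \<Sum>F | F \<in> forests V k \<and> e' \<in> F. \<Prod>d\<in>F - {e'}. x d) =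
      (\<lambda>x. \<Sum>F | F \<in> {F \<in> forests V k. e' \<in> F} \<and> e \<in> F - {e'}. \<Prod>d\<in>F - {e'} - {e}. x d)"
    using finite_forests[OF V, of k] fin by (intro partial_deriv_multilinear) auto
  moreover have "{F. F \<in> {F \<in> forests V k. e' \<in> F} \<and> e \<in> F - {e'}} =
      (if e = e' then {} else {F \<in> forests V k. e \<in> F \<and> e' \<in> F})" by auto
  ultimately show ?thesis by simp
qed

text \<open>Intersections of size \<open>0\<close> and \<open>1\<close> give \<open>b\<close> and
  \<open>a\<close>; the coefficient \<open>2 * a - b\<close> makes the diagonal, with intersection
  size \<open>2\<close>, vanish.\<close>

lemma hessian_forest_poly_entry_eq:
  assumes V: "finite V" and "4 \<le> card V" "0 < k" "k + 2 \<le> card V"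
  obtains a b :: real where "0 < a" "a \<le> b" "b < 2 * a"
    and "\<And>e e'. e \<in> all_edges V \<Longrightarrow> e' \<in> all_edges V \<Longrightarrow>
      partial_deriv e (partial_deriv e' (forest_poly V k)) (\<lambda>_. 1) =
      b - (2 * a - b) * of_bool (e = e') - (b - a) * real (card (e \<inter> e'))"
proof -
  from forest_edge_pair_counts[OF assms] obtain p q where pq: "0 < q + p"
    and adj: "\<forall>u v w. distinct [u, v, w] \<longrightarrow> {u, v, w} \<subseteq> V \<longrightarrow>
      card {F \<in> forests V k. {u, v} \<in> F \<and> {v, w} \<in> F} = q + 3 * p"
    and disj: "\<forall>u v w x. distinct [u, v, w, x] \<longrightarrow> {u, v, w, x} \<subseteq> V \<longrightarrow>
      card {F \<in> forests V k. {u, v} \<in> F \<and> {w, x} \<in> F} = q + 4 * p"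
    by (elim exE conjE)
  define a where "a = real (q + 3 * p)"
  define b where "b = real (q + 4 * p)"
  have "partial_deriv e (partial_deriv e' (forest_poly V k)) (\<lambda>_. 1) =
      b - (2 * a - b) * of_bool (e = e') - (b - a) * real (card (e \<inter> e'))"
    if e: "e \<in> all_edges V" and e': "e' \<in> all_edges V" for e e'
  proof -
    obtain u v where uv: "e = {u, v}" "u \<noteq> v" "u \<in> V" "v \<in> V"
      using e by (auto simp: all_edges_def card_2_iff)
    obtain w x where wx: "e' = {w, x}" "w \<noteq> x" "w \<in> V" "x \<in> V"
      using e' by (auto simp: all_edges_def card_2_iff)
    consider "e = e'" | y z z' where "e = {y, z}" "e' = {z, z'}" "distinct [y, z, z']" "{y, z, z'} \<subseteq> V"
      | "distinct [u, v, w, x]"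
    proof (cases "e = e'")
      case False
      consider "u = w" | "u = x" | "v = w" | "v = x" | "distinct [u, v, w, x]"
        using uv wx by fastforce
      then show ?thesis
      proof cases
        case 1
        then show ?thesis using False uv wx by (intro that(2)[of v u x]) auto
      next
        case 2
        then show ?thesis using False uv wx by (intro that(2)[of v u w]) auto
      next
        case 3
        then show ?thesis using False uv wx by (intro that(2)[of u v x]) auto
      next
        case 4
        then show ?thesis using False uv wx by (intro that(2)[of u v w]) auto
      qed (rule that(3))
    qed (rule that(1))
    then show ?thesis
    proof cases
      case 1
      then have "card (e \<inter> e') = 2" using e by (simp add: all_edges_def)
      with 1 show ?thesis using hessian_forest_poly_entry[OF V, of e e' k] by simp
    next
      case (2 y z z')
      then have "e \<inter> e' = {z}" "e \<noteq> e'" by auto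
      moreover have "card {F \<in> forests V k. e \<in> F \<and> e' \<in> F} = q + 3 * p"
        unfolding 2(1,2) using adj 2(3,4) by blast
      ultimately show ?thesis
        using hessian_forest_poly_entry[OF V, of e e' k] by (simp add: a_def)
    next
      case 3
      then have "e \<inter> e' = {}" "e \<noteq> e'" using uv wx by auto
      moreover have "card {F \<in> forests V k. e \<in> F \<and> e' \<in> F} = q + 4 * p"
        unfolding uv(1) wx(1) using disj 3 uv wx by simp
      ultimately show ?thesis
        using hessian_forest_poly_entry[OF V, of e e' k] by (simp add: b_def)
    qed
  qed
  \<comment> \<open>Here \<open>2 * a - b\<close> equals \<open>q + 2 * p\<close>, positive since
    \<open>q + p\<close> is.\<close>
  moreover have "0 < a" "a \<le> b" "b < 2 * a" using pq by (auto simp: a_def b_def)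
  ultimately show ?thesis using that by blast
qed

section \<open>Incidences between vertices and edges\<close>

lemma card_edges_at_vertex:
  assumes "finite V" "v \<in> V"
  shows "card {e \<in> all_edges V. v \<in> e} = card V - 1"
proof -
  have "{e \<in> all_edges V. v \<in> e} = (\<lambda>w. {v, w}) ` (V - {v})"
    using assms(2) by (auto simp: all_edges_def card_2_iff image_iff doubleton_eq_iff)
  moreover have "inj_on (\<lambda>w. {v, w}) (V - {v})" by (auto simp: inj_on_def doubleton_eq_iff)
  ultimately show ?thesis using assms by (simp add: card_image)
qed

lemma card_Int_eq_sum:
  assumes "finite V" "e \<subseteq> V"
  shows "real (card (e \<inter> e')) = (\<Sum>v\<in>V. of_bool (v \<in> e) * of_bool (v \<in> e'))"
proof -
  have "e \<inter> e' = {v \<in> V. v \<in> e \<and> v \<in> e'}" using assms by auto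
  then show ?thesis using assms(1) by (simp add: of_bool_conj[symmetric] sum_of_bool_eq Int_def)
qed

text \<open>Double counting: each of the two endpoints of \<open>e\<close> lies on
  \<open>card V - 1\<close> edges.\<close>

lemma sum_card_Int_all_edges:
  assumes V: "finite V" and e: "e \<in> all_edges V"
  shows "(\<Sum>e'\<in>all_edges V. real (card (e \<inter> e'))) = 2 * real (card V - 1)"
proof -
  have eV: "e \<subseteq> V" "card e = 2" "finite e" using e V by (auto simp: all_edges_def intro: finite_subset)
  have "(\<Sum>e'\<in>all_edges V. real (card (e \<inter> e'))) =
      (\<Sum>v\<in>e. \<Sum>e'\<in>all_edges V. of_bool (v \<in> e'))"
    using card_Int_eq_sum[OF eV(3) subset_refl] by (subst sum.swap) simp
  also have "\<dots> = (\<Sum>v\<in>e. real (card {e' \<in> all_edges V. v \<in> e'}))"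
    using finite_all_edges[OF V] by (simp add: sum_of_bool_eq Int_def)
  also have "\<dots> = (\<Sum>v\<in>e. real (card V - 1))"
    using eV card_edges_at_vertex[OF V] by (intro sum.cong) auto
  finally show ?thesis using eV by simp
qed

section \<open>Row sums, quadratic form and signature of the Hessian\<close>

theorem theorem2p4:
  fixes n k :: nat and es :: "nat set list" and H :: "real mat"
  assumes "n \<ge> 3" and "0 < k" and "k < n - 2"
    and "distinct es" and "set es = all_edges {1..n}"
    and "H = hessian_mat es (forest_poly {1..n} k) (\<lambda>e. 1)"
  shows "Determinant.det H \<noteq> 0 \<and> num_pos_eigenvalues H = 1"
proof -
  let ?V = "{1..n}"
  let ?m = "length es"
  obtain a b :: real where ab: "0 < a" "a \<le> b" "b < 2 * a"
    and entry: "\<And>e e'. e \<in> all_edges ?V \<Longrightarrow> e' \<in> all_edges ?V \<Longrightarrow>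
      partial_deriv e (partial_deriv e' (forest_poly ?V k)) (\<lambda>_. 1) =
      b - (2 * a - b) * of_bool (e = e') - (b - a) * real (card (e \<inter> e'))"
  proof (rule hessian_forest_poly_entry_eq[of ?V k])
    \<comment> \<open>The bounds \<open>0 < k < n - 2\<close> force
      \<open>n \<ge> 4\<close>.\<close>
    show "4 \<le> card ?V" "k + 2 \<le> card ?V" using assms(2,3) by auto
  qed (use assms(2) in auto)
  have H: "H \<in> carrier_mat ?m ?m" by (simp add: assms(6) hessian_mat_def)
  have mem: "es ! i \<in> all_edges ?V" if "i < ?m" for i using that assms(5) nth_mem by metis
  have Hij: "H $$ (i, j) =
      b - (2 * a - b) * of_bool (i = j) - (b - a) * real (card (es ! i \<inter> es ! j))"
    if "i < ?m" "j < ?m" for i j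
    using entry[OF mem[OF that(1)] mem[OF that(2)]] that
    by (simp add: assms(6) hessian_mat_def nth_eq_iff_index_eq[OF assms(4)])
  have sym: "H $$ (i, j) = H $$ (j, i)" if "i < ?m" "j < ?m" for i j
    using Hij[OF that] Hij[OF that(2,1)] by (simp add: Int_commute eq_commute)
  define l where "l = ?m * b - (2 * a - b) - (b - a) * (2 * real (card ?V - 1))"
  have row: "(\<Sum>j<?m. H $$ (i, j)) = l" if i: "i < ?m" for i
  proof -
    have "(\<Sum>j<?m. real (card (es ! i \<inter> es ! j))) = (\<Sum>e'\<in>all_edges ?V. real (card (es ! i \<inter> e')))"
      using sum.reindex_bij_betw[OF bij_betw_nth[OF assms(4), of "{..<?m}" "set es"]] assms(5) by simp
    also have "\<dots> = 2 * real (card ?V - 1)"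
      using sum_card_Int_all_edges[OF _ mem[OF i]] by simp
    finally have s: "(\<Sum>j<?m. real (card (es ! i \<inter> es ! j))) = 2 * real (card ?V - 1)" .
    have "(\<Sum>j<?m. H $$ (i, j)) = (\<Sum>j<?m. b) - (\<Sum>j<?m. (2 * a - b) * of_bool (i = j)) -
        (\<Sum>j<?m. (b - a) * real (card (es ! i \<inter> es ! j)))"
      using Hij[OF i] by (simp add: sum_subtractf)
    also have "\<dots> = l"
      using i s by (simp add: l_def of_bool_def if_distrib flip: sum_distrib_left cong: if_cong)
    finally show ?thesis .
  qed
  \<comment> \<open>Two different edges provide an off-diagonal entry. The sign of \<open>l\<close>
    is read off from the entries of its row, not from its formula.\<close>
  have "{{1, 2}, {1, 3}} \<subseteq> set es" using assms(1,5) by (auto simp: all_edges_def)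
  moreover have "{1, 2} \<noteq> {1, 3 :: nat}" by (auto simp: doubleton_eq_iff)
  ultimately obtain i j where ij: "i < ?m" "j < ?m" "i \<noteq> j"
    by (metis in_set_conv_nth insert_subset)
  have nonneg: "H $$ (r, c) \<ge> 0" and pos: "r \<noteq> c \<Longrightarrow> H $$ (r, c) > 0"
    if rc: "r < ?m" "c < ?m" for r c
  proof -
    have fin: "finite (es ! r)" "card (es ! r) = 2" "card (es ! c) = 2"
      using mem rc by (auto simp: all_edges_def intro: card_ge_0_finite)
    show "H $$ (r, c) > 0" if "r \<noteq> c"
    proof -
      have ne: "es ! r \<noteq> es ! c" using that rc assms(4) by (simp add: nth_eq_iff_index_eq)
      have "card (es ! r \<inter> es ! c) \<noteq> 2"
        using ne fin by (metis card_subset_eq card.infinite inf_le1 inf_le2 zero_neq_numeral)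
      moreover have "card (es ! r \<inter> es ! c) \<le> 2" using fin by (metis card_mono inf_le1)
      ultimately have "card (es ! r \<inter> es ! c) \<le> 1" by linarith
      \<comment> \<open>Distinct edges share at most one vertex, so the entry is at least
        \<open>b - (b - a) = a\<close>.\<close>
      then have "(b - a) * real (card (es ! r \<inter> es ! c)) \<le> b - a"
        using ab by (simp add: mult_left_le)
      then show ?thesis using Hij[OF rc] that ab by simp
    qed
    then show "H $$ (r, c) \<ge> 0" using Hij[OF rc] fin by (cases "r = c") auto
  qed
  have "0 < (\<Sum>c<?m. H $$ (i, c))"
    using ij nonneg pos by (intro sum_pos2[of _ j]) auto
  then have l: "0 < l" using row ij by simp
  have neg: "(\<Sum>r<?m. \<Sum>c<?m. x r * H $$ (r, c) * x c) < 0"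
    if ex: "\<exists>r<?m. x r \<noteq> 0" and s0: "(\<Sum>r<?m. x r) = 0" for x :: "nat \<Rightarrow> real"
  proof -
    \<comment> \<open>The incidence matrix applied to \<open>x\<close>: the intersection part of the
      form becomes the sum of the squares of \<open>y v\<close>.\<close>
    define y where "y v = (\<Sum>r<?m. of_bool (v \<in> es ! r) * x r)" for v
    have "x r * H $$ (r, c) * x c = b * (x r * x c) - (2 * a - b) * (of_bool (r = c) * (x r * x c)) -
        (b - a) * (\<Sum>v\<in>?V. (of_bool (v \<in> es ! r) * x r) * (of_bool (v \<in> es ! c) * x c))"
      if "r < ?m" "c < ?m" for r c
    proof -
      have "es ! r \<subseteq> ?V" using mem[OF that(1)] by (simp add: all_edges_def)
      then have c: "real (card (es ! r \<inter> es ! c)) = (\<Sum>v\<in>?V. of_bool (v \<in> es ! r) * of_bool (v \<in> es ! c))"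
        by (intro card_Int_eq_sum) auto
      have d: "(\<Sum>v\<in>?V. (of_bool (v \<in> es ! r) * x r) * (of_bool (v \<in> es ! c) * x c)) =
          real (card (es ! r \<inter> es ! c)) * (x r * x c)"
        unfolding c sum_distrib_right by (intro sum.cong refl) (simp only: mult_ac)
      show ?thesis unfolding Hij[OF that] d by (simp only: left_diff_distrib right_diff_distrib mult_ac)
    qed
    then have "(\<Sum>r<?m. \<Sum>c<?m. x r * H $$ (r, c) * x c) =
        (\<Sum>r<?m. \<Sum>c<?m. b * (x r * x c) - (2 * a - b) * (of_bool (r = c) * (x r * x c)) -
          (b - a) * (\<Sum>v\<in>?V. (of_bool (v \<in> es ! r) * x r) * (of_bool (v \<in> es ! c) * x c)))"
      by (intro sum.cong refl) simp
    also have "\<dots> = b * (\<Sum>r<?m. \<Sum>c<?m. x r * x c) -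
        (2 * a - b) * (\<Sum>r<?m. \<Sum>c<?m. of_bool (r = c) * (x r * x c)) -
        (b - a) * (\<Sum>r<?m. \<Sum>c<?m. \<Sum>v\<in>?V. (of_bool (v \<in> es ! r) * x r) * (of_bool (v \<in> es ! c) * x c))"
      by (simp only: sum_subtractf sum_distrib_left)
    \<comment> \<open>The all-ones part of the form is the square of the coordinate sum.\<close>
    also have "(\<Sum>r<?m. \<Sum>c<?m. x r * x c) = 0"
      using s0 by (simp flip: sum_product)
    also have "(\<Sum>r<?m. \<Sum>c<?m. of_bool (r = c) * (x r * x c)) = (\<Sum>r<?m. (x r)\<^sup>2)"
    proof (rule sum.cong)
      fix r assume "r \<in> {..<?m}"
      have "(\<Sum>c<?m. of_bool (r = c) * (x r * x c)) = (\<Sum>c<?m. if c = r then x r * x r else 0)"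
        by (intro sum.cong) auto
      then show "(\<Sum>c<?m. of_bool (r = c) * (x r * x c)) = (x r)\<^sup>2"
        using \<open>r \<in> {..<?m}\<close> by (simp add: power2_eq_square)
    qed simp
    also have "(\<Sum>r<?m. \<Sum>c<?m. \<Sum>v\<in>?V. (of_bool (v \<in> es ! r) * x r) * (of_bool (v \<in> es ! c) * x c)) =
        (\<Sum>r<?m. \<Sum>v\<in>?V. \<Sum>c<?m. (of_bool (v \<in> es ! r) * x r) * (of_bool (v \<in> es ! c) * x c))"
      by (intro sum.cong refl sum.swap)
    also have "\<dots> = (\<Sum>v\<in>?V. \<Sum>r<?m. \<Sum>c<?m. (of_bool (v \<in> es ! r) * x r) * (of_bool (v \<in> es ! c) * x c))"
      by (rule sum.swap)
    also have "\<dots> = (\<Sum>v\<in>?V. (y v)\<^sup>2)"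
      by (simp only: y_def power2_eq_square sum_product)
    finally have "(\<Sum>r<?m. \<Sum>c<?m. x r * H $$ (r, c) * x c) =
        - ((2 * a - b) * (\<Sum>r<?m. (x r)\<^sup>2)) - (b - a) * (\<Sum>v\<in>?V. (y v)\<^sup>2)" by simp
    moreover have "(\<Sum>r<?m. (x r)\<^sup>2) > 0"
    proof -
      obtain r where "r < ?m" "x r \<noteq> 0" using ex by blast
      then show ?thesis by (intro sum_pos2[of _ r]) auto
    qed
    then have "(2 * a - b) * (\<Sum>r<?m. (x r)\<^sup>2) > 0" using ab by simp
    moreover have "(b - a) * (\<Sum>v\<in>?V. (y v)\<^sup>2) \<ge> 0" using ab by (simp add: sum_nonneg)
    ultimately show ?thesis by linarith
  qed
  have col: "(\<Sum>r<?m. H $$ (r, c)) = l" if "c < ?m" for c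
    using row[OF that] sym that by simp
  have m: "0 < ?m" using ij by linarith
  show ?thesis
    using det_and_num_pos_eigenvalues_if_neg_def[OF H m l row col neg] by blast
qed

end
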